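(* Let $V_1,V_2\in C^\infty(\mathbb{R},\mathbb{R})$, $m\in\mathbb{R}$, and $K_i(z_i,w_i)=\frac{w_i^2}{2}+V_i(z_i^2)$ for $i=1,2$. Let $J\subset\mathbb{R}$ be an open interval such that for every $a\in J$, with $b=m-a$, the level sets $\{K_1=a\}$ and $\{K_2=b\}$ are regular closed simple curves in $\mathbb{R}^2$. Let $I_1(a)$ and $I_2(b)$ be the corresponding action variables, with inverse functions $a=h_1(I_1)$ and $b=h_2(I_2)$, and regard $I_2$ as a function of $I_1$ through the relation $h_1(I_1)+h_2(I_2)=m$. Then: (i) $I_2$ is a convex function of $I_1$ if $h_1''(I_1)<0$ and $h_2''(I_2)<0$ (for all values of $I_1$, $I_2$ that occur); (ii) $I_2$ is a concave function of $I_1$ if $h_1''(I_1)>0$ and $h_2''(I_2)>0$ (for all values of $I_1$, $I_2$ that occur).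
   Context: The action variables are $I_1(a)=\frac{1}{2\pi}\int_{\{K_1=a\}}w_1\,dz_1$ and $I_2(b)=\frac{1}{2\pi}\int_{\{K_2=b\}}w_2\,dz_2$, i.e. $\frac{1}{2\pi}$ times the areas enclosed by the closed curves $\{K_1=a\}$ and $\{K_2=b\}$; they are strictly increasing in $a\in J$ and $b\in m-J$ respectively. That $I_2$ is regarded as a function of $I_1$ means: the function $\varphi:I_1(J)\to\mathbb{R}$ with $\varphi(I_1(a))=I_2(m-a)$ for all $a\in J$. *)

theory Defs
  imports "HOL-Analysis.Analysis"
begin

definition smooth :: "(real \<Rightarrow> real) \<Rightarrow> bool" where
  "smooth f \<longleftrightarrow> (\<forall>n x. (deriv ^^ n) f differentiable (at x))"

definition energy :: "(real \<Rightarrow> real) \<Rightarrow> real \<times> real \<Rightarrow> real" where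
  "energy V = (\<lambda>(z, w). w\<^sup>2 / 2 + V (z\<^sup>2))"

definition level_set :: "(real \<times> real \<Rightarrow> real) \<Rightarrow> real \<Rightarrow> (real \<times> real) set" where
  "level_set K a = {p. K p = a}"

text \<open>The last conjunct makes the curve close up without a corner, so that its
  periodic extension is a regular curve as well.\<close>

definition regular_simple_loop :: "(real \<Rightarrow> real \<times> real) \<Rightarrow> bool" where
  "regular_simple_loop \<gamma> \<longleftrightarrow>
     simple_path \<gamma> \<and> pathfinish \<gamma> = pathstart \<gamma> \<and>
     \<gamma> C1_differentiable_on {0..1} \<and>
     (\<forall>t\<in>{0..1}. vector_derivative \<gamma> (at t) \<noteq> 0) \<and>
     vector_derivative \<gamma> (at 0) = vector_derivative \<gamma> (at 1)"

definition regular_closed_simple_curve :: "(real \<times> real) set \<Rightarrow> bool" where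
  "regular_closed_simple_curve C \<longleftrightarrow> (\<exists>\<gamma>. regular_simple_loop \<gamma> \<and> path_image \<gamma> = C)"

text \<open>The line integral of the 1-form \<open>w dz\<close> along \<open>\<gamma>\<close>.\<close>

definition integral_w_dz :: "(real \<Rightarrow> real \<times> real) \<Rightarrow> real" where
  "integral_w_dz \<gamma> = integral {0..1} (\<lambda>t. snd (\<gamma> t) * fst (vector_derivative \<gamma> (at t)))"

text \<open>Regular parametrizations of the same closed simple curve give the same line integral
  up to a sign depending on the orientation. The absolute value selects the orientation
  for which the integral is the enclosed area.\<close>

definition action :: "(real \<times> real \<Rightarrow> real) \<Rightarrow> real \<Rightarrow> real" where
  "action K a =
     1 / (2 * pi) *
       \<bar>integral_w_dz (SOME \<gamma>. regular_simple_loop \<gamma> \<and> path_image \<gamma> = level_set K a)\<bar>"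

end

theory Submission
  imports Defs
begin

text \<open>On \<open>I1 ` J\<close> the relation says \<open>h2 (\<phi> x) = m - h1 x\<close>. If both \<open>h1\<close> and \<open>h2\<close> are concave, the
right-hand side is convex in \<open>x\<close>, so \<open>h2\<close> at the value of \<open>\<phi>\<close> at a convex combination is at most
\<open>h2\<close> at the convex combination of the values; as \<open>h2\<close> is increasing, \<open>\<phi>\<close> is convex
(\<open>convexity_of_implicit_function\<close>). The other case is the same with all inequalities reversed.

What takes work is the claim that the signs of \<open>h1''\<close> and \<open>h2''\<close> decide concavity: the action
variables have to be twice differentiable with positive derivative. Otherwise \<open>deriv (deriv h)\<close>
would be an unspecified value, and the inverse \<open>h\<close> might not even exist. Write \<open>U z = V (z\<^sup>2)\<close>.

The first step is the shape of a level curve. A regular closed simple curve \<open>w\<^sup>2 / 2 + U z = a\<close>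
bounds a potential well: for some \<open>r > 0\<close> one has \<open>U < a\<close> on the open interval from \<open>- r\<close> to \<open>r\<close>,
\<open>U > a\<close> beyond it, \<open>U = a\<close> at \<open>\<plusminus>r\<close>, and \<open>U' r > 0\<close> (\<open>regular_level_set_imp_well\<close>). Here
simplicity of the curve excludes further zeros of \<open>a - U\<close>, and regularity excludes a critical
turning point. The curve is then the union of the two graphs \<open>w = \<plusminus>sqrt (2 (a - U z))\<close>, traversed in
opposite directions, so every parametrization gives, up to sign, twice the integral of the
square root (\<open>abs_integral_w_dz_well\<close>).

The second step is the dependence of this integral on \<open>a\<close>. The integrand is not differentiable
in \<open>a\<close> at the moving turning point \<open>r\<close>. The integral is therefore cut at a point \<open>z1 < r\<close> with
\<open>U' > 0\<close> on \<open>[z1, r]\<close>. Left of \<open>z1\<close> the integrand is smooth and Leibniz' rule applies. Right of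
\<open>z1\<close>, with \<open>g\<close> the local inverse of \<open>U\<close> and \<open>v1 = U z1\<close>, the substitution
\<open>z = g (a - (a - v1) s\<^sup>2)\<close> turns the integral into \<open>2 sqrt 2 (a - v1)\<^bsup>3/2\<^esup>\<close> times the integral over
\<open>0 \<le> s \<le> 1\<close> of \<open>s\<^sup>2 g' (a - (a - v1) s\<^sup>2)\<close>, which again is smooth in \<open>a\<close>. The left part has
positive derivative and the right part is increasing (\<open>well_integral_regular\<close>).\<close>


section \<open>Real functions on an arc or a loop\<close>

lemma no_zero_between_imp_same_sign:
  fixes w :: "real \<Rightarrow> real"
  assumes cont: "continuous_on {c..d} w" and nz: "\<And>t. c < t \<Longrightarrow> t < d \<Longrightarrow> w t \<noteq> 0"
  obtains \<sigma> where "\<bar>\<sigma>\<bar> = 1" "\<And>t. t \<in> {c..d} \<Longrightarrow> \<sigma> * w t = \<bar>w t\<bar>"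
proof -
  have "(\<forall>t\<in>{c..d}. 0 \<le> w t) \<or> (\<forall>t\<in>{c..d}. w t \<le> 0)"
  proof (rule ccontr)
    assume "\<not> ?thesis"
    then obtain s t where st: "s \<in> {c..d}" "t \<in> {c..d}" "w s < 0" "0 < w t"
      by (auto simp: not_le)
    have "\<exists>x. min s t \<le> x \<and> x \<le> max s t \<and> w x = 0"
    proof (cases "s \<le> t")
      case True
      have "continuous_on {s..t} w"
        using cont by (rule continuous_on_subset) (use st in auto)
      then show ?thesis
        using IVT'[of w s 0 t] True st by auto
    next
      case False
      have "continuous_on {t..s} w"
        using cont by (rule continuous_on_subset) (use st in auto)
      then show ?thesis
        using IVT2'[of w s 0 t] False st by auto
    qed
    then obtain x where x: "min s t \<le> x" "x \<le> max s t" "w x = 0"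
      by blast
    have "x \<noteq> s" "x \<noteq> t"
      using x(3) st by auto
    then have "c < x" "x < d"
      using x st by auto
    then show False
      using nz x(3) by blast
  qed
  then show thesis
  proof
    assume "\<forall>t\<in>{c..d}. 0 \<le> w t"
    then show thesis
      by (intro that[of 1]) auto
  next
    assume "\<forall>t\<in>{c..d}. w t \<le> 0"
    then show thesis
      by (intro that[of "-1"]) auto
  qed
qed

text \<open>A loop minus one point is still connected, so a function with a single zero on the loop does not
change sign. In the unit interval the loop minus \<open>p\<close> falls apart into the pieces before and after
\<open>p\<close>; they are linked by \<open>z 0 = z 1\<close>.\<close>

lemma loop_minus_point_same_sign:
  fixes z :: "real \<Rightarrow> real"
  assumes cont: "continuous_on {0..1} z" and loop: "z 0 = z 1"
    and zero: "\<And>t. t \<in> {0..<1} \<Longrightarrow> z t = 0 \<Longrightarrow> t = p" and p: "p \<in> {0..<1}" "z p = 0"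
  shows "(\<forall>t\<in>{0..1}. 0 \<le> z t) \<or> (\<forall>t\<in>{0..1}. z t \<le> 0)"
proof -
  obtain \<sigma> where \<sigma>: "\<bar>\<sigma>\<bar> = 1" "\<And>t. t \<in> {0..p} \<Longrightarrow> \<sigma> * z t = \<bar>z t\<bar>"
    using no_zero_between_imp_same_sign[of 0 p z] continuous_on_subset[OF cont] p zero
    by (metis atLeastAtMost_iff atLeastLessThan_iff less_eq_real_def linorder_not_less order.strict_trans subsetI)
  obtain \<tau> where \<tau>: "\<bar>\<tau>\<bar> = 1" "\<And>t. t \<in> {p..1} \<Longrightarrow> \<tau> * z t = \<bar>z t\<bar>"
    using no_zero_between_imp_same_sign[of p 1 z] continuous_on_subset[OF cont] p zero
    by (metis atLeastAtMost_iff atLeastLessThan_iff less_eq_real_def linorder_not_less order_trans subsetI)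
  show ?thesis
  proof (cases "z 0 = 0")
    case True
    then have "p = 0"
      using zero[of 0] by simp
    then have "\<And>t. t \<in> {0..1} \<Longrightarrow> 0 \<le> \<tau> * z t"
      using \<tau> by simp
    then show ?thesis
      using \<tau>(1) by (cases "\<tau> = 1") (auto simp: abs_if split: if_splits)
  next
    case False
    have "\<sigma> * z 0 = \<tau> * z 0"
      using \<sigma>(2)[of 0] \<tau>(2)[of 1] p(1) loop by simp
    then have "\<sigma> = \<tau>"
      using False by simp
    have "0 \<le> \<sigma> * z t" if "t \<in> {0..1}" for t
      using \<sigma>(2)[of t] \<tau>(2)[of t] \<open>\<sigma> = \<tau>\<close> that by (cases "t \<le> p") auto
    then show ?thesis
      using \<sigma>(1) by (cases "\<sigma> = 1") (auto simp: abs_if split: if_splits)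
  qed
qed

lemma regular_simple_loop_components:
  assumes "regular_simple_loop \<gamma>"
  shows "continuous_on {0..1} (\<lambda>t. fst (\<gamma> t))" "continuous_on {0..1} (\<lambda>t. snd (\<gamma> t))"
    and "\<gamma> 0 = \<gamma> 1" and "inj_on \<gamma> {0..<1}" and "path_image \<gamma> = \<gamma> ` {0..<1}"
    and "\<And>t. t \<in> {0..1} \<Longrightarrow>
      ((\<lambda>t. fst (\<gamma> t)) has_real_derivative fst (vector_derivative \<gamma> (at t))) (at t)"
    and "\<And>t. t \<in> {0..1} \<Longrightarrow>
      ((\<lambda>t. snd (\<gamma> t)) has_real_derivative snd (vector_derivative \<gamma> (at t))) (at t)"
proof -
  have sp: "simple_path \<gamma>" and loop: "\<gamma> 1 = \<gamma> 0" and C1: "\<gamma> C1_differentiable_on {0..1}"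
    using assms by (auto simp: regular_simple_loop_def pathfinish_def pathstart_def)
  have "continuous_on {0..1} \<gamma>"
    using sp by (simp add: simple_path_def path_def)
  then show "continuous_on {0..1} (\<lambda>t. fst (\<gamma> t))" "continuous_on {0..1} (\<lambda>t. snd (\<gamma> t))"
    by (auto intro: continuous_intros)
  show "\<gamma> 0 = \<gamma> 1" using loop by simp
  show "inj_on \<gamma> {0..<1}"
    using sp by (force simp: simple_path_def loop_free_def inj_on_def)
  show "path_image \<gamma> = \<gamma> ` {0..<1}"
  proof -
    have "{0..1::real} = insert 1 {0..<1}"
      by auto
    then show ?thesis
      unfolding path_image_def using loop by (metis (no_types, lifting) atLeastLessThan_iff
          image_insert insert_absorb imageI order_refl zero_less_one)
  qed
  fix t :: real
  assume "t \<in> {0..1}"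
  then have "(\<gamma> has_vector_derivative vector_derivative \<gamma> (at t)) (at t)"
    using C1 by (auto simp: C1_differentiable_on_eq vector_derivative_works)
  then show "((\<lambda>t. fst (\<gamma> t)) has_real_derivative fst (vector_derivative \<gamma> (at t))) (at t)"
    "((\<lambda>t. snd (\<gamma> t)) has_real_derivative snd (vector_derivative \<gamma> (at t))) (at t)"
    unfolding has_real_derivative_iff_has_vector_derivative
    by (auto intro: bounded_linear.has_vector_derivative[OF bounded_linear_fst]
        bounded_linear.has_vector_derivative[OF bounded_linear_snd])
qed

text \<open>If the maximum sits at the base point, each end of the parameter interval only gives one sign of
the derivative; the matching of the derivatives at the ends combines the two.\<close>

lemma derivative_zero_at_loop_max:
  fixes z z' :: "real \<Rightarrow> real"
  assumes der: "\<And>t. t \<in> {0..1} \<Longrightarrow> (z has_real_derivative z' t) (at t)"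
    and loop: "z 0 = z 1" "z' 0 = z' 1"
    and p: "p \<in> {0..<1}" and max: "\<And>t. t \<in> {0..1} \<Longrightarrow> z t \<le> z p"
  shows "z' p = 0"
proof (cases "p = 0")
  case False
  then have "\<forall>y. \<bar>p - y\<bar> < min p (1 - p) \<longrightarrow> z y \<le> z p"
    using p max by (auto simp: abs_if split: if_splits)
  then show ?thesis
    using DERIV_local_max[of z "z' p" p "min p (1 - p)"] der p False by auto
next
  case True
  have "\<not> 0 < z' 0"
  proof
    assume "0 < z' 0"
    then obtain d where d: "d > 0" "\<And>h. 0 < h \<Longrightarrow> h < d \<Longrightarrow> z 0 < z (0 + h)"
      using DERIV_pos_inc_right[of z "z' 0" 0] der[of 0] by auto
    have "z 0 < z (min (d/2) 1)"
      using d(2)[of "min (d/2) 1"] d(1) by auto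
    then show False
      using max[of "min (d/2) 1"] d(1) True by auto
  qed
  moreover have "\<not> z' 1 < 0"
  proof
    assume "z' 1 < 0"
    then obtain d where d: "d > 0" "\<And>h. 0 < h \<Longrightarrow> h < d \<Longrightarrow> z 1 < z (1 - h)"
      using DERIV_neg_dec_left[of z "z' 1" 1] der[of 1] by auto
    have "z 1 < z (1 - min (d/2) 1)"
      using d(2)[of "min (d/2) 1"] d(1) by auto
    then show False
      using max[of "1 - min (d/2) 1"] d(1) True loop by auto
  qed
  ultimately show ?thesis
    using True loop by simp
qed

text \<open>Used at a turning point: a bound of the increments of \<open>w\<close> by those of \<open>z\<close> prevents the velocity
from being vertical there.\<close>

lemma derivative_dominated:
  fixes w z :: "real \<Rightarrow> real"
  assumes "(w has_real_derivative w') (at p within S)" "(z has_real_derivative z') (at p within S)"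
    and "at p within S \<noteq> bot"
    and dom: "\<forall>\<^sub>F t in at p within S. \<bar>w t - w p\<bar> \<le> C * \<bar>z t - z p\<bar>"
  shows "\<bar>w'\<bar> \<le> C * \<bar>z'\<bar>"
proof (rule tendsto_le)
  show "((\<lambda>t. \<bar>(w t - w p) / (t - p)\<bar>) \<longlongrightarrow> \<bar>w'\<bar>) (at p within S)"
    using assms(1) unfolding has_field_derivative_iff by (rule tendsto_rabs)
  show "((\<lambda>t. C * \<bar>(z t - z p) / (t - p)\<bar>) \<longlongrightarrow> C * \<bar>z'\<bar>) (at p within S)"
    using assms(2) unfolding has_field_derivative_iff by (intro tendsto_intros)
  show "\<forall>\<^sub>F t in at p within S. \<bar>(w t - w p) / (t - p)\<bar> \<le> C * \<bar>(z t - z p) / (t - p)\<bar>"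
    using dom by eventually_elim (auto simp: abs_divide intro: divide_right_mono)
qed (use assms in auto)

lemma quadratic_bound_at_critical_point:
  fixes U U1 U2 :: "real \<Rightarrow> real"
  assumes U: "\<And>x. (U has_real_derivative U1 x) (at x)" "\<And>x. (U1 has_real_derivative U2 x) (at x)"
    and "continuous_on UNIV U2" and crit: "U1 r = 0"
  obtains M where "0 \<le> M" "\<And>x. \<bar>x - r\<bar> \<le> 1 \<Longrightarrow> \<bar>U x - U r\<bar> \<le> M * (x - r)\<^sup>2"
proof -
  have "bounded (U2 ` cball r 1)"
    by (intro compact_imp_bounded compact_continuous_image continuous_on_subset[OF assms(3)]) auto
  then obtain M where "\<forall>y\<in>U2 ` cball r 1. norm y \<le> M"
    unfolding bounded_iff by blast
  then have M: "\<And>x. x \<in> cball r 1 \<Longrightarrow> \<bar>U2 x\<bar> \<le> M"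
    by simp
  have M0: "0 \<le> M"
    using M[of r] by auto
  have lip: "\<bar>U1 x - U1 r\<bar> \<le> M * \<bar>x - r\<bar>" if "x \<in> cball r 1" for x
    using field_differentiable_bound[of "cball r 1" U1 U2 M x r] that U(2) M
    by (auto intro: has_field_derivative_at_within)
  show thesis
  proof (rule that[OF M0])
    fix x assume x: "\<bar>x - r\<bar> \<le> 1"
    let ?d = "\<bar>x - r\<bar>"
    have "\<bar>U x - U r\<bar> \<le> (M * ?d) * \<bar>x - r\<bar>"
    proof (rule field_differentiable_bound[of "cball r ?d" U U1, unfolded real_norm_def])
      fix y assume y: "y \<in> cball r ?d"
      then have "y \<in> cball r 1"
        using x by (auto simp: dist_real_def)
      then have "\<bar>U1 y\<bar> \<le> M * \<bar>y - r\<bar>"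
        using lip crit by force
      also have "\<dots> \<le> M * ?d"
        using y M0 by (intro mult_left_mono) (auto simp: dist_real_def abs_minus_commute)
      finally show "\<bar>U1 y\<bar> \<le> M * ?d" .
    qed (use U(1) in \<open>auto intro: has_field_derivative_at_within simp: dist_real_def abs_minus_commute\<close>)
    then show "\<bar>U x - U r\<bar> \<le> M * (x - r)\<^sup>2"
      by (simp add: power2_eq_square algebra_simps flip: abs_mult)
  qed
qed

section \<open>Level curves and potential wells\<close>

lemma energy_level_param:
  fixes U :: "real \<Rightarrow> real"
  assumes \<gamma>: "regular_simple_loop \<gamma>" and image: "path_image \<gamma> = {(z, w). w\<^sup>2 / 2 + U z = a}"
  shows "\<And>t. t \<in> {0..1} \<Longrightarrow> (snd (\<gamma> t))\<^sup>2 / 2 + U (fst (\<gamma> t)) = a"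
    and "\<And>x y. y\<^sup>2 / 2 + U x = a \<Longrightarrow> \<exists>t\<in>{0..<1}. fst (\<gamma> t) = x \<and> snd (\<gamma> t) = y"
proof -
  fix t :: real
  assume "t \<in> {0..1}"
  then have "\<gamma> t \<in> path_image \<gamma>"
    by (simp add: path_image_def)
  then show "(snd (\<gamma> t))\<^sup>2 / 2 + U (fst (\<gamma> t)) = a"
    unfolding image by (simp add: case_prod_beta)
next
  fix x y :: real
  assume "y\<^sup>2 / 2 + U x = a"
  then have "(x, y) \<in> \<gamma> ` {0..<1}"
    using image regular_simple_loop_components(5)[OF \<gamma>] by auto
  then show "\<exists>t\<in>{0..<1}. fst (\<gamma> t) = x \<and> snd (\<gamma> t) = y"
    by (metis fst_conv image_iff snd_conv)
qed

text \<open>The projection of the curve to the \<open>z\<close>-axis is \<open>{z. U z \<le> a}\<close>; it is compact, connected and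
symmetric, hence an interval \<open>[- r, r]\<close>. At the parameter where \<open>z\<close> is maximal the velocity is
vertical and nonzero. If \<open>U' r = 0\<close>, then \<open>a - U z\<close> is \<open>O((z - r)\<^sup>2)\<close>, so \<open>w = O(z - r)\<close> along the
curve, and the velocity would vanish. Finally, over an interior zero \<open>x\<close> of \<open>a - U\<close> the curve has
the single point \<open>(x, 0)\<close>, and removing it would separate the left and the right part of the curve,
which is impossible for a simple loop.\<close>

lemma regular_level_set_imp_well:
  fixes U U1 U2 :: "real \<Rightarrow> real"
  assumes U: "\<And>x. (U has_real_derivative U1 x) (at x)" "\<And>x. (U1 has_real_derivative U2 x) (at x)"
    and U2: "continuous_on UNIV U2" and even: "\<And>x. U (- x) = U x"
    and \<gamma>: "regular_simple_loop \<gamma>" and image: "path_image \<gamma> = {(z, w). w\<^sup>2 / 2 + U z = a}"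
  obtains r where "0 < r" "\<And>z. U z \<le> a \<longleftrightarrow> \<bar>z\<bar> \<le> r" "\<And>z. U z = a \<longleftrightarrow> \<bar>z\<bar> = r" "0 < U1 r"
proof -
  define z w z' w' where "z = (\<lambda>t. fst (\<gamma> t))" and "w = (\<lambda>t. snd (\<gamma> t))"
    and "z' = (\<lambda>t. fst (vector_derivative \<gamma> (at t)))"
    and "w' = (\<lambda>t. snd (vector_derivative \<gamma> (at t)))"
  note zw_defs = z_def w_def z'_def w'_def
  note comp = regular_simple_loop_components[OF \<gamma>, folded zw_defs]
  have dz: "(z has_real_derivative z' t) (at t)" and dw: "(w has_real_derivative w' t) (at t)"
    if "t \<in> {0..1}" for t
    using comp(6,7)[OF that] by (simp_all add: z'_def w'_def)
  have loop: "z 0 = z 1" "z' 0 = z' 1" and regular: "\<And>t. t \<in> {0..1} \<Longrightarrow> z' t \<noteq> 0 \<or> w' t \<noteq> 0"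
    using \<gamma> comp(3) by (auto simp: zw_defs regular_simple_loop_def prod_eq_iff)
  have on_curve: "(w t)\<^sup>2 / 2 + U (z t) = a" if "t \<in> {0..1}" for t
    using energy_level_param(1)[OF \<gamma> image that] by (simp add: zw_defs)
  have hit: "\<exists>t\<in>{0..<1}. z t = x \<and> w t = y" if "y\<^sup>2 / 2 + U x = a" for x y
    using energy_level_param(2)[OF \<gamma> image that] by (simp add: zw_defs)
  have range_z: "z ` {0..1} = {x. U x \<le> a}"
  proof (intro equalityI subsetI)
    fix x assume "x \<in> z ` {0..1}"
    then obtain t where "t \<in> {0..1}" "x = z t"
      by blast
    moreover have "0 \<le> (w t)\<^sup>2 / 2"
      by simp
    ultimately show "x \<in> {x. U x \<le> a}"
      using on_curve[of t] by (metis add_increasing2 add.commute mem_Collect_eq order_refl)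
  next
    fix x assume "x \<in> {x. U x \<le> a}"
    then have "(sqrt (2 * (a - U x)))\<^sup>2 / 2 + U x = a"
      by (simp add: field_simps)
    then show "x \<in> z ` {0..1}"
      using hit by force
  qed
  obtain p where p: "p \<in> {0..<1}" and max: "\<And>t. t \<in> {0..1} \<Longrightarrow> z t \<le> z p"
  proof -
    obtain p where "p \<in> {0..1}" "\<And>t. t \<in> {0..1} \<Longrightarrow> z t \<le> z p"
      using continuous_attains_sup[of "{0..1}" z] comp(1) by auto
    then show thesis
      using that[of 0] that[of p] loop by (cases "p = 1") auto
  qed
  define r where "r = z p"
  have outside: "a < U x" if "r < x" for x
  proof (rule ccontr)
    assume "\<not> a < U x"
    then have "x \<in> z ` {0..1}"
      using range_z by simp
    then show False
      using max that unfolding r_def by force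
  qed
  have Ur_le: "U r \<le> a"
    using range_z p unfolding r_def by force
  have r0: "0 \<le> r"
    using outside[of "- r"] Ur_le even[of r] by force
  have le_iff: "U x \<le> a \<longleftrightarrow> \<bar>x\<bar> \<le> r" for x
  proof
    assume "U x \<le> a"
    then show "\<bar>x\<bar> \<le> r"
      using outside[of x] outside[of "- x"] even[of x] by fastforce
  next
    assume "\<bar>x\<bar> \<le> r"
    then have "x \<in> {- r..r}"
      by auto
    moreover have "{- r..r} \<subseteq> z ` {0..1}"
    proof (rule connected_contains_Icc)
      show "connected (z ` {0..1})"
        using comp(1) by (intro connected_continuous_image) auto
    qed (use range_z Ur_le even[of r] in auto)
    ultimately show "U x \<le> a"
      using range_z by auto
  qed
  have contU: "isCont U x" for x
    using U(1) by (rule DERIV_isCont)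
  have "a \<le> U r"
  proof (rule tendsto_lowerbound)
    show "(U \<longlongrightarrow> U r) (at_right r)"
      using contU[of r] by (simp add: isCont_def filterlim_at_split)
    show "\<forall>\<^sub>F x in at_right r. a \<le> U x"
      using outside by (intro eventually_at_rightI[of r "r + 1"]) (auto intro: less_imp_le)
  qed auto
  then have Ur: "U r = a"
    using Ur_le by simp
  have wp: "w p = 0"
    using on_curve[of p] p Ur by (simp add: r_def)
  have z'p: "z' p = 0"
    by (rule derivative_zero_at_loop_max[OF dz loop p max])
  \<comment> \<open>a critical turning point would force the velocity at \<open>p\<close> to vanish\<close>
  have "U1 r \<noteq> 0"
  proof
    assume "U1 r = 0"
    then obtain M where M: "0 \<le> M" "\<And>x. \<bar>x - r\<bar> \<le> 1 \<Longrightarrow> \<bar>U x - U r\<bar> \<le> M * (x - r)\<^sup>2"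
      using quadratic_bound_at_critical_point[OF U U2] by blast
    have "\<bar>w' p\<bar> \<le> sqrt (2 * M) * \<bar>z' p\<bar>"
    proof (rule derivative_dominated)
      show "(w has_real_derivative w' p) (at p within {0..1})" "(z has_real_derivative z' p) (at p within {0..1})"
        using dw[of p] dz[of p] p by (auto intro: has_field_derivative_at_within)
      show "at p within {0..1} \<noteq> bot"
        using p by (simp add: trivial_limit_within)
      have "(z \<longlongrightarrow> z p) (at p within {0..1})"
        using comp(1) p by (auto simp: continuous_on)
      then have "\<forall>\<^sub>F t in at p within {0..1}. dist (z t) (z p) < 1"
        by (rule tendstoD) simp
      moreover have "\<forall>\<^sub>F t in at p within {0..1}. t \<in> {0..1}"
        by (simp add: eventually_at_filter)
      ultimately show "\<forall>\<^sub>F t in at p within {0..1}. \<bar>w t - w p\<bar> \<le> sqrt (2 * M) * \<bar>z t - z p\<bar>"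
      proof eventually_elim
        case (elim t)
        have "(w t)\<^sup>2 = 2 * (U r - U (z t))"
          using on_curve[OF elim(2)] Ur by (simp add: field_simps)
        also have "\<dots> \<le> 2 * (M * (z t - r)\<^sup>2)"
          using M(2)[of "z t"] elim(1) by (simp add: dist_real_def r_def)
        finally have "sqrt ((w t)\<^sup>2) \<le> sqrt (2 * M * (z t - r)\<^sup>2)"
          unfolding real_sqrt_le_iff by (simp add: mult.assoc)
        then show ?case
          by (simp add: real_sqrt_mult wp r_def)
      qed
    qed
    then have "w' p = 0"
      using z'p by simp
    then show False
      using regular[of p] z'p p by auto
  qed
  moreover have "\<not> U1 r < 0"
  proof
    assume "U1 r < 0"
    then obtain d where "d > 0" "\<And>h. 0 < h \<Longrightarrow> h < d \<Longrightarrow> U (r + h) < U r"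
      using DERIV_neg_dec_right[OF U(1)] by blast
    then have "U (r + d / 2) < U r"
      by simp
    then show False
      using outside[of "r + d / 2"] \<open>d > 0\<close> Ur by simp
  qed
  ultimately have U1r: "0 < U1 r"
    by simp
  have "r \<noteq> 0"
  proof
    assume "r = 0"
    have "((\<lambda>x. U (- x)) has_real_derivative U1 (- 0) * (- 1)) (at 0)"
      by (rule DERIV_chain2[OF U(1)]) (auto intro!: derivative_eq_intros)
    then have "(U has_real_derivative - U1 0) (at 0)"
      by (simp add: even)
    then have "U1 0 = - U1 0"
      using DERIV_unique U(1) by blast
    then show False
      using U1r \<open>r = 0\<close> by simp
  qed
  then have rpos: "0 < r"
    using r0 by simp
  \<comment> \<open>an interior zero would be a point whose removal disconnects the loop\<close>
  have eq_iff: "U x = a \<longleftrightarrow> \<bar>x\<bar> = r" for x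
  proof
    assume "\<bar>x\<bar> = r"
    then show "U x = a"
      using Ur even[of r] by (auto simp: abs_if split: if_splits)
  next
    assume Ux: "U x = a"
    show "\<bar>x\<bar> = r"
    proof (rule ccontr)
      assume "\<bar>x\<bar> \<noteq> r"
      then have x: "- r < x" "x < r"
        using le_iff[of x] Ux by auto
      obtain q where q: "q \<in> {0..<1}" "z q = x" "w q = 0"
        using hit[of 0 x] Ux by auto
      have "(\<forall>t\<in>{0..1}. 0 \<le> z t - x) \<or> (\<forall>t\<in>{0..1}. z t - x \<le> 0)"
      proof (rule loop_minus_point_same_sign)
        fix t :: real assume t: "t \<in> {0..<1}" "z t - x = 0"
        then have "w t = 0"
          using on_curve[of t] Ux by auto
        then have "\<gamma> t = \<gamma> q"
          using t q by (simp add: zw_defs prod_eq_iff)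
        then show "t = q"
          using comp(4) t q by (auto dest: inj_onD)
      qed (use comp(1) loop q in \<open>auto intro: continuous_intros\<close>)
      then show False
      proof
        assume *: "\<forall>t\<in>{0..1}. 0 \<le> z t - x"
        obtain t where "t \<in> {0..1}" "z t = - r"
          using range_z Ur even[of r] by (metis image_iff mem_Collect_eq order_refl)
        then show False
          using bspec[OF *, of t] x by simp
      next
        assume "\<forall>t\<in>{0..1}. z t - x \<le> 0"
        from bspec[OF this, of p] show False
          using p x by (simp add: r_def)
      qed
    qed
  qed
  show thesis
    using that rpos le_iff eq_iff U1r by blast
qed

text \<open>With \<open>F\<close> a primitive of \<open>sqrt (2 (a - U))\<close>, the 1-form \<open>w dz\<close> is \<open>dF\<close> on the upper and \<open>- dF\<close> on
the lower half of the curve. The half curves meet at the two turning points only. The parameters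
\<open>s \<le> t\<close> of these points cut \<open>[0, 1]\<close> into three intervals, of which the outer two together form one
half; each half contributes \<open>F r\<close> with the same sign. If the base point is a turning point, the
first interval is degenerate.\<close>

lemma abs_integral_w_dz_well:
  fixes U :: "real \<Rightarrow> real"
  assumes U: "continuous_on UNIV U" and r: "0 < r"
    and le_iff: "\<And>z. U z \<le> a \<longleftrightarrow> \<bar>z\<bar> \<le> r" and eq_iff: "\<And>z. U z = a \<longleftrightarrow> \<bar>z\<bar> = r"
    and \<gamma>: "regular_simple_loop \<gamma>" and image: "path_image \<gamma> = {(z, w). w\<^sup>2 / 2 + U z = a}"
  shows "\<bar>integral_w_dz \<gamma>\<bar> = 2 * integral {- r..r} (\<lambda>z. sqrt (2 * (a - U z)))"
proof -
  define z w z' where "z = (\<lambda>t. fst (\<gamma> t))" and "w = (\<lambda>t. snd (\<gamma> t))"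
    and "z' = (\<lambda>t. fst (vector_derivative \<gamma> (at t)))"
  note zw_defs = z_def w_def z'_def
  note comp = regular_simple_loop_components[OF \<gamma>, folded zw_defs]
  have on_curve: "(w t)\<^sup>2 / 2 + U (z t) = a" if "t \<in> {0..1}" for t
    using energy_level_param(1)[OF \<gamma> image that] by (simp add: zw_defs)
  have hit: "\<exists>t\<in>{0..<1}. z t = x \<and> w t = y" if "y\<^sup>2 / 2 + U x = a" for x y
    using energy_level_param(2)[OF \<gamma> image that] by (simp add: zw_defs)
  have loop: "z 0 = z 1" "w 0 = w 1"
    using comp(3) by (simp_all add: zw_defs)
  have z_in: "z t \<in> {- r..r}" if "t \<in> {0..1}" for t
    using on_curve[OF that] le_iff[of "z t"] zero_le_power2[of "w t"] by (auto simp: abs_le_iff)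
  define F where "F = (\<lambda>x. integral {- r..x} (\<lambda>z. sqrt (2 * (a - U z))))"
  have F': "(F has_real_derivative sqrt (2 * (a - U x))) (at x within {- r..r})" if "x \<in> {- r..r}" for x
    unfolding F_def using that
    by (intro integral_has_real_derivative continuous_intros continuous_on_subset[OF U]) auto
  have F0: "F (- r) = 0"
    by (simp add: F_def)
  have Fr: "0 \<le> F r"
    unfolding F_def using le_iff by (intro integral_nonneg integrable_continuous_real
        continuous_intros continuous_on_subset[OF U]) (auto simp: abs_le_iff)
  have arc: "\<exists>\<sigma>. \<bar>\<sigma>\<bar> = 1 \<and> (\<forall>t\<in>{c..d}. \<sigma> * w t = \<bar>w t\<bar>) \<and>
      ((\<lambda>t. w t * z' t) has_integral \<sigma> * (F (z d) - F (z c))) {c..d}"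
    if cd: "0 \<le> c" "c \<le> d" "d \<le> 1" and nz: "\<And>t. c < t \<Longrightarrow> t < d \<Longrightarrow> w t \<noteq> 0" for c d
  proof -
    obtain \<sigma> where \<sigma>: "\<bar>\<sigma>\<bar> = 1" "\<And>t. t \<in> {c..d} \<Longrightarrow> \<sigma> * w t = \<bar>w t\<bar>"
      using no_zero_between_imp_same_sign[OF continuous_on_subset[OF comp(2)] nz] cd
      by (metis atLeastatMost_subset_iff)
    have "((\<lambda>t. w t * z' t) has_integral \<sigma> * F (z d) - \<sigma> * F (z c)) {c..d}"
    proof (rule fundamental_theorem_of_calculus[OF cd(2)])
      fix t assume t: "t \<in> {c..d}"
      have t01: "t \<in> {0..1}"
        using t cd by auto
      have "\<bar>w t\<bar> = sqrt (2 * (a - U (z t)))"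
        using on_curve[OF t01] by (simp flip: real_sqrt_abs add: algebra_simps)
      moreover have "w t = \<sigma> * (\<sigma> * w t)"
        using \<sigma>(1) by (metis abs_mult_self_eq mult.assoc mult_1)
      ultimately have wt: "w t = \<sigma> * sqrt (2 * (a - U (z t)))"
        using \<sigma>(2)[OF t] by simp
      have "(F has_real_derivative sqrt (2 * (a - U (z t)))) (at (z t) within z ` {c..d})"
        by (rule DERIV_subset[OF F'[OF z_in[OF t01]]]) (use z_in cd in auto)
      moreover have "(z has_real_derivative z' t) (at t within {c..d})"
        using comp(6)[OF t01] by (simp add: z'_def has_field_derivative_at_within)
      ultimately have "(F \<circ> z has_real_derivative sqrt (2 * (a - U (z t))) * z' t) (at t within {c..d})"
        by (rule DERIV_image_chain)
      from DERIV_cmult[OF this, of \<sigma>]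
      show "((\<lambda>t. \<sigma> * F (z t)) has_vector_derivative w t * z' t) (at t within {c..d})"
        unfolding has_real_derivative_iff_has_vector_derivative[symmetric]
        by (simp add: wt mult.assoc)
    qed
    then show ?thesis
      using \<sigma> by (auto simp: right_diff_distrib)
  qed
  obtain p q where p: "p \<in> {0..<1}" "z p = r" "w p = 0" and q: "q \<in> {0..<1}" "z q = - r" "w q = 0"
    using hit[of 0 r] hit[of 0 "- r"] eq_iff r by auto
  define s t where "s = min p q" and "t = max p q"
  have st: "0 \<le> s" "s \<le> t" "t \<le> 1" "s < 1" "t < 1"
    using p q by (auto simp: s_def t_def)
  have zst: "z s = r \<and> z t = - r \<or> z s = - r \<and> z t = r"
    using p q by (auto simp: s_def t_def min_def max_def)
  have zero: "x = s \<or> x = t" if "x \<in> {0..<1}" "w x = 0" for x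
  proof -
    have "\<bar>z x\<bar> = r"
      using on_curve[of x] that eq_iff[of "z x"] by auto
    then have "\<gamma> x = \<gamma> p \<or> \<gamma> x = \<gamma> q"
      using that p q by (auto simp: zw_defs prod_eq_iff)
    then have "x = p \<or> x = q"
      using comp(4) that p q by (auto dest: inj_onD)
    then show ?thesis
      by (auto simp: s_def t_def)
  qed
  have nz: "w x \<noteq> 0" if "0 \<le> x" "x < 1" "x \<noteq> s" "x \<noteq> t" for x
    using zero[of x] that by auto
  obtain \<sigma>0 where \<sigma>0: "\<bar>\<sigma>0\<bar> = 1" "\<And>x. x \<in> {0..s} \<Longrightarrow> \<sigma>0 * w x = \<bar>w x\<bar>"
    "((\<lambda>t. w t * z' t) has_integral \<sigma>0 * (F (z s) - F (z 0))) {0..s}"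
    using arc[of 0 s] nz st by fastforce
  obtain \<sigma> where \<sigma>: "\<bar>\<sigma>\<bar> = 1" "\<And>x. x \<in> {s..t} \<Longrightarrow> \<sigma> * w x = \<bar>w x\<bar>"
    "((\<lambda>t. w t * z' t) has_integral \<sigma> * (F (z t) - F (z s))) {s..t}"
    using arc[of s t] nz st by fastforce
  obtain \<sigma>1 where \<sigma>1: "\<bar>\<sigma>1\<bar> = 1" "\<And>x. x \<in> {t..1} \<Longrightarrow> \<sigma>1 * w x = \<bar>w x\<bar>"
    "((\<lambda>t. w t * z' t) has_integral \<sigma>1 * (F (z 1) - F (z t))) {t..1}"
    using arc[of t 1] nz st by fastforce
  have "((\<lambda>t. w t * z' t) has_integral \<sigma>0 * (F (z s) - F (z 0)) + \<sigma> * (F (z t) - F (z s)) +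
      \<sigma>1 * (F (z 1) - F (z t))) {0..1}"
    using st by (intro has_integral_combine[of 0 t 1] has_integral_combine[of 0 s t] \<sigma>0 \<sigma> \<sigma>1) auto
  then have total: "integral_w_dz \<gamma> = \<sigma>0 * (F (z s) - F (z 0)) + \<sigma> * (F (z t) - F (z s)) +
      \<sigma>1 * (F (z 1) - F (z t))"
    unfolding integral_w_dz_def zw_defs by (rule integral_unique)
  \<comment> \<open>both outer intervals lie on the half curve through the base point\<close>
  have ends: "s = 0 \<or> \<sigma>0 = \<sigma>1"
  proof (cases "s = 0")
    case False
    then have "w 0 \<noteq> 0"
      using nz[of 0] st by auto
    moreover have "\<sigma>0 * w 0 = \<sigma>1 * w 0"
      using \<sigma>0(2)[of 0] \<sigma>1(2)[of 1] st loop by simp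
    ultimately show ?thesis
      by simp
  qed simp
  \<comment> \<open>the curve meets both half planes, so the middle interval has the other sign\<close>
  have "\<sigma>1 \<noteq> \<sigma>"
  proof
    assume eq: "\<sigma>1 = \<sigma>"
    have sign: "0 \<le> \<sigma> * w x" if "x \<in> {0..<1}" for x
    proof -
      consider "x \<in> {0..s}" | "x \<in> {s..t}" | "x \<in> {t..1}"
        using \<open>x \<in> {0..<1}\<close> by fastforce
      then show ?thesis
      proof cases
        case 1
        then show ?thesis
          using \<sigma>0(2)[of x] \<sigma>(2)[of x] ends eq st by (cases "s = 0") auto
      qed (use \<sigma>(2)[of x] \<sigma>1(2)[of x] eq in auto)
    qed
    have "U 0 < a"
      using le_iff[of 0] eq_iff[of 0] r by simp
    define h where "h = sqrt (2 * (a - U 0))"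
    have "h > 0" "h\<^sup>2 / 2 + U 0 = a" "(- h)\<^sup>2 / 2 + U 0 = a"
      using \<open>U 0 < a\<close> by (auto simp: h_def field_simps)
    obtain x where x: "x \<in> {0..<1}" "w x = h"
      using hit[OF \<open>h\<^sup>2 / 2 + U 0 = a\<close>] by blast
    obtain y where y: "y \<in> {0..<1}" "w y = - h"
      using hit[OF \<open>(- h)\<^sup>2 / 2 + U 0 = a\<close>] by blast
    show False
      using x y sign[of x] sign[of y] \<open>h > 0\<close> \<sigma>(1) by (auto simp: zero_le_mult_iff mult_le_0_iff)
  qed
  then have \<sigma>1_eq: "\<sigma>1 = - \<sigma>"
    using \<sigma>(1) \<sigma>1(1) by (auto simp: abs_if split: if_splits)
  have "\<sigma>0 * (F (z s) - F (z 0)) = \<sigma>1 * (F (z s) - F (z 0))"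
    using ends by auto
  then have "integral_w_dz \<gamma> = \<sigma> * (2 * (F (z t) - F (z s)))"
    unfolding total \<sigma>1_eq using loop by (simp add: algebra_simps)
  then have "\<bar>integral_w_dz \<gamma>\<bar> = 2 * \<bar>F (z t) - F (z s)\<bar>"
    using \<sigma>(1) by (simp add: abs_mult del: right_diff_distrib_numeral)
  also have "\<dots> = 2 * F r"
    using zst F0 Fr by auto
  finally show ?thesis
    by (simp add: F_def)
qed

section \<open>Integrals depending on the energy\<close>

definition twice_differentiable_on :: "(real \<Rightarrow> real) \<Rightarrow> real set \<Rightarrow> bool" where
  "twice_differentiable_on f S \<longleftrightarrow> (\<exists>f1 f2. (\<forall>x\<in>S. (f has_real_derivative f1 x) (at x)) \<and>
     (\<forall>x\<in>S. (f1 has_real_derivative f2 x) (at x)))"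

lemma twice_differentiable_onI:
  assumes "\<And>x. x \<in> S \<Longrightarrow> (f has_real_derivative f1 x) (at x)"
    and "\<And>x. x \<in> S \<Longrightarrow> (f1 has_real_derivative f2 x) (at x)"
  shows "twice_differentiable_on f S"
  using assms unfolding twice_differentiable_on_def by blast

lemma twice_differentiable_on_mult:
  assumes "twice_differentiable_on f S" "twice_differentiable_on g S"
  shows "twice_differentiable_on (\<lambda>x. f x * g x) S"
proof -
  from assms obtain f1 f2 g1 g2
    where f: "\<And>x. x \<in> S \<Longrightarrow> (f has_real_derivative f1 x) (at x)"
      "\<And>x. x \<in> S \<Longrightarrow> (f1 has_real_derivative f2 x) (at x)"
      and g: "\<And>x. x \<in> S \<Longrightarrow> (g has_real_derivative g1 x) (at x)"
      "\<And>x. x \<in> S \<Longrightarrow> (g1 has_real_derivative g2 x) (at x)"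
    unfolding twice_differentiable_on_def by blast
  have "((\<lambda>x. f x * g x) has_real_derivative f x * g1 x + f1 x * g x) (at x)" if "x \<in> S" for x
    using DERIV_mult'[OF f(1) g(1)] that by simp
  moreover have "((\<lambda>x. f x * g1 x + f1 x * g x) has_real_derivative
      (f x * g2 x + f1 x * g1 x) + (f1 x * g1 x + f2 x * g x)) (at x)" if "x \<in> S" for x
    using DERIV_add[OF DERIV_mult'[OF f(1) g(2)] DERIV_mult'[OF f(2) g(1)]] that by simp
  ultimately show ?thesis
    by (rule twice_differentiable_onI)
qed

lemma has_derivatives_parameter_integral:
  fixes f f1 f2 :: "real \<Rightarrow> real \<Rightarrow> real"
  assumes N: "open N" "convex N"
    and f1: "\<And>a t. a \<in> N \<Longrightarrow> t \<in> {c..d} \<Longrightarrow> ((\<lambda>a. f a t) has_real_derivative f1 a t) (at a)"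
    and f2: "\<And>a t. a \<in> N \<Longrightarrow> t \<in> {c..d} \<Longrightarrow> ((\<lambda>a. f1 a t) has_real_derivative f2 a t) (at a)"
    and cont: "continuous_on (N \<times> {c..d}) (\<lambda>(a, t). f a t)"
      "continuous_on (N \<times> {c..d}) (\<lambda>(a, t). f1 a t)"
      "continuous_on (N \<times> {c..d}) (\<lambda>(a, t). f2 a t)"
    and a: "a \<in> N"
  shows "((\<lambda>a. integral {c..d} (f a)) has_real_derivative integral {c..d} (f1 a)) (at a)"
    and "((\<lambda>a. integral {c..d} (f1 a)) has_real_derivative integral {c..d} (f2 a)) (at a)"
proof -
  have slice: "g b integrable_on {c..d}"
    if "continuous_on (N \<times> {c..d}) (\<lambda>(a, t). g a t)" "b \<in> N" for g :: "real \<Rightarrow> real \<Rightarrow> real" and b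
  proof (rule integrable_continuous_real)
    have "continuous_on {c..d} (\<lambda>t. case (b, t) of (a, t) \<Rightarrow> g a t)"
      by (rule continuous_on_compose2[OF that(1)]) (intro continuous_intros, use that(2) in auto)
    then show "continuous_on {c..d} (g b)"
      by simp
  qed
  have *: "((\<lambda>a. integral (cbox c d) (f a)) has_real_derivative integral (cbox c d) (f1 a)) (at a within N)"
    by (rule leibniz_rule_field_derivative)
      (use f1 cont slice N a in \<open>auto intro: has_field_derivative_at_within\<close>)
  have **: "((\<lambda>a. integral (cbox c d) (f1 a)) has_real_derivative integral (cbox c d) (f2 a)) (at a within N)"
    by (rule leibniz_rule_field_derivative)
      (use f2 cont slice N a in \<open>auto intro: has_field_derivative_at_within\<close>)
  show "((\<lambda>a. integral {c..d} (f a)) has_real_derivative integral {c..d} (f1 a)) (at a)"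
    "((\<lambda>a. integral {c..d} (f1 a)) has_real_derivative integral {c..d} (f2 a)) (at a)"
    using * ** at_within_open[OF a N(1)] by simp_all
qed

text \<open>The part of the action integral away from the turning points. Its strictly positive derivative
makes the derivative of the whole action positive, so that for the remaining part monotonicity is
enough.\<close>

lemma bulk_integral_derivatives:
  fixes U :: "real \<Rightarrow> real"
  assumes U: "continuous_on UNIV U" and N: "open N" "convex N"
    and below: "\<And>a z. a \<in> N \<Longrightarrow> z \<in> {c..d} \<Longrightarrow> U z < a" and "c < d"
  shows "\<exists>D1 D2. \<forall>a\<in>N. ((\<lambda>a. integral {c..d} (\<lambda>z. sqrt (2 * (a - U z)))) has_real_derivative D1 a) (at a) \<and>
      (D1 has_real_derivative D2 a) (at a) \<and> 0 < D1 a"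
proof -
  define f f1 f2 where "f = (\<lambda>a z. sqrt (2 * (a - U z)))"
    and "f1 = (\<lambda>a z. inverse (sqrt (2 * (a - U z))))"
    and "f2 = (\<lambda>a z. - (inverse (sqrt (2 * (a - U z))) ^ 3))"
  note f_defs = f_def f1_def f2_def
  have d1: "((\<lambda>a. f a z) has_real_derivative f1 a z) (at a)" if "a \<in> N" "z \<in> {c..d}" for a z
    unfolding f_defs using below[OF that]
    by (auto intro!: derivative_eq_intros simp: field_simps)
  have d2: "((\<lambda>a. f1 a z) has_real_derivative f2 a z) (at a)" if "a \<in> N" "z \<in> {c..d}" for a z
    unfolding f_defs using below[OF that]
    by (auto intro!: derivative_eq_intros simp: power3_eq_cube field_simps)
  have contU: "continuous_on (N \<times> {c..d}) (\<lambda>p. U (snd p))"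
    by (rule continuous_on_compose2[OF U]) (auto intro: continuous_intros)
  have cont: "continuous_on (N \<times> {c..d}) (\<lambda>(a, t). f a t)" "continuous_on (N \<times> {c..d}) (\<lambda>(a, t). f1 a t)"
    "continuous_on (N \<times> {c..d}) (\<lambda>(a, t). f2 a t)"
    unfolding f_defs case_prod_beta
    using below by (auto intro!: continuous_intros contU) force+
  have pos: "0 < integral {c..d} (f1 a)" if a: "a \<in> N" for a
  proof -
    have cont_a: "continuous_on {c..d} (f1 a)"
      unfolding f1_def using below[OF a]
      by (auto intro!: continuous_intros continuous_on_subset[OF U]) force
    have pos: "0 < f1 a z" if "z \<in> {c..d}" for z
      using below[OF a that] by (simp add: f1_def)
    have "0 \<le> integral {c..d} (f1 a)"
      using cont_a pos by (intro integral_nonneg integrable_continuous_real) (auto intro: less_imp_le)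
    moreover have "integral {c..d} (f1 a) \<noteq> 0"
      using integral_eq_0_iff[OF cont_a] \<open>c < d\<close> pos by (force simp: less_imp_le)
    ultimately show ?thesis
      by simp
  qed
  show ?thesis
  proof (intro exI ballI conjI)
    fix a assume "a \<in> N"
    note * = has_derivatives_parameter_integral[OF N d1 d2 cont this]
    show "((\<lambda>a. integral {c..d} (\<lambda>z. sqrt (2 * (a - U z)))) has_real_derivative integral {c..d} (f1 a)) (at a)"
      using *(1) by (simp add: f_def)
    show "((\<lambda>a. integral {c..d} (f1 a)) has_real_derivative integral {c..d} (f2 a)) (at a)"
      using *(2) by simp
    show "0 < integral {c..d} (f1 a)"
      using pos \<open>a \<in> N\<close> by simp
  qed
qed

text \<open>The function of \<open>a\<close> is the desingularized action integral near a turning point when \<open>k\<close> is the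
derivative of the local inverse of the potential.\<close>

lemma edge_integral_twice_differentiable:
  fixes k k1 k2 :: "real \<Rightarrow> real"
  assumes k: "\<And>v. v \<in> T \<Longrightarrow> (k has_real_derivative k1 v) (at v)"
      "\<And>v. v \<in> T \<Longrightarrow> (k1 has_real_derivative k2 v) (at v)"
    and cont: "continuous_on T k2" and T: "{v1..v2} \<subseteq> T"
  shows "twice_differentiable_on
    (\<lambda>a. sqrt (a - v1) ^ 3 * integral {0..1} (\<lambda>s. s\<^sup>2 * k (a - (a - v1) * s\<^sup>2))) {v1<..<v2}"
proof (rule twice_differentiable_on_mult)
  let ?N = "{v1<..<v2}"
  have "((\<lambda>a. sqrt (a - v1) ^ 3) has_real_derivative 3 / 2 * sqrt (a - v1)) (at a)"
    if "a \<in> ?N" for a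
    using that by (auto intro!: derivative_eq_intros simp: power2_eq_square field_simps)
  moreover have "((\<lambda>a. 3 / 2 * sqrt (a - v1)) has_real_derivative 3 / (4 * sqrt (a - v1))) (at a)"
    if "a \<in> ?N" for a
    using that by (auto intro!: derivative_eq_intros simp: field_simps)
  ultimately show "twice_differentiable_on (\<lambda>a. sqrt (a - v1) ^ 3) ?N"
    by (rule twice_differentiable_onI)
next
  let ?N = "{v1<..<v2}"
  let ?v = "\<lambda>a s. a - (a - v1) * s\<^sup>2"
  have v: "?v a s \<in> T" if "a \<in> ?N" "s \<in> {0..1}" for a s
  proof -
    have "s\<^sup>2 \<le> 1"
      using that by (simp add: power_le_one)
    moreover have a: "v1 < a" "a < v2"
      using that by auto
    ultimately have "0 \<le> (a - v1) * s\<^sup>2" "(a - v1) * s\<^sup>2 \<le> a - v1"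
      by (auto intro: mult_left_le)
    then have "?v a s \<in> {v1..v2}"
      unfolding atLeastAtMost_iff using a by (intro conjI; linarith)
    then show ?thesis
      using T by blast
  qed
  have dv: "((\<lambda>a. ?v a s) has_real_derivative (1 - s\<^sup>2)) (at a)" for a s
    by (auto intro!: derivative_eq_intros)
  have contv: "continuous_on (?N \<times> {0..1}) (\<lambda>p. c (?v (fst p) (snd p)))"
    if "continuous_on T c" for c :: "real \<Rightarrow> real"
    by (rule continuous_on_compose2[OF that]) (auto intro!: continuous_intros v)
  have contk: "continuous_on T k" "continuous_on T k1"
    by (rule DERIV_continuous_on, rule has_field_derivative_at_within, erule k)+
  let ?f = "\<lambda>a s. s\<^sup>2 * k (?v a s)"
  let ?f1 = "\<lambda>a s. s\<^sup>2 * (k1 (?v a s) * (1 - s\<^sup>2))"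
  let ?f2 = "\<lambda>a s. s\<^sup>2 * (k2 (?v a s) * (1 - s\<^sup>2) * (1 - s\<^sup>2))"
  show "twice_differentiable_on (\<lambda>a. integral {0..1} (?f a)) ?N"
  proof (rule twice_differentiable_onI)
    fix a assume a: "a \<in> ?N"
    have d1: "((\<lambda>a. ?f a s) has_real_derivative ?f1 a s) (at a)" if "a \<in> ?N" "s \<in> {0..1}" for a s
      by (rule DERIV_cmult[OF DERIV_chain2[where f=k and g="\<lambda>a. ?v a s", OF k(1) dv]]) (rule v[OF that])
    have d2: "((\<lambda>a. ?f1 a s) has_real_derivative ?f2 a s) (at a)" if "a \<in> ?N" "s \<in> {0..1}" for a s
      by (rule DERIV_cmult[OF DERIV_cmult_right[OF DERIV_chain2[where f=k1 and g="\<lambda>a. ?v a s", OF k(2) dv]]]) (rule v[OF that])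
    have cont: "continuous_on (?N \<times> {0..1}) (\<lambda>(a, t). ?f a t)"
      "continuous_on (?N \<times> {0..1}) (\<lambda>(a, t). ?f1 a t)"
      "continuous_on (?N \<times> {0..1}) (\<lambda>(a, t). ?f2 a t)"
      unfolding case_prod_beta by (intro continuous_intros contv contk cont)+
    note * = has_derivatives_parameter_integral[OF _ _ d1 d2 cont a]
    show "((\<lambda>a. integral {0..1} (?f a)) has_real_derivative integral {0..1} (?f1 a)) (at a)"
      by (rule *(1)) auto
    show "((\<lambda>a. integral {0..1} (?f1 a)) has_real_derivative integral {0..1} (?f2 a)) (at a)"
      by (rule *(2)) auto
  qed
qed

text \<open>Since \<open>U (g v) = v\<close>, the substitution \<open>z = g (a - (a - v1) s\<^sup>2)\<close> makes \<open>a - U z = (a - v1) s\<^sup>2\<close>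
a perfect square; this removes the square root singularity, and the interval of integration no
longer depends on \<open>a\<close>.\<close>

lemma edge_integral_substitution:
  fixes U g k :: "real \<Rightarrow> real"
  assumes U: "continuous_on UNIV U" and a: "v1 < a"
    and g: "\<And>v. v \<in> {v1..a} \<Longrightarrow> (g has_real_derivative k v) (at v)"
    and inv: "\<And>v. v \<in> {v1..a} \<Longrightarrow> U (g v) = v" and mono: "g v1 < g a"
  shows "integral {g v1..g a} (\<lambda>z. sqrt (2 * (a - U z))) =
     2 * sqrt 2 * (sqrt (a - v1) ^ 3 * integral {0..1} (\<lambda>s. s\<^sup>2 * k (a - (a - v1) * s\<^sup>2)))"
proof -
  let ?v = "\<lambda>s. a - (a - v1) * s\<^sup>2"
  let ?f = "\<lambda>z. sqrt (2 * (a - U z))"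
  let ?d = "\<lambda>s. k (?v s) * (- (a - v1) * (2 * s))"
  have v: "?v s \<in> {v1..a}" if "s \<in> {0..1}" for s
  proof -
    have "s\<^sup>2 \<le> 1"
      using that by (simp add: power_le_one)
    then have "0 \<le> (a - v1) * s\<^sup>2" "(a - v1) * s\<^sup>2 \<le> a - v1"
      using a by (auto intro: mult_left_le)
    then show ?thesis
      unfolding atLeastAtMost_iff by (intro conjI; linarith)
  qed
  have d: "((\<lambda>s. g (?v s)) has_real_derivative ?d s) (at s)" if "s \<in> {0..1}" for s
    by (rule DERIV_chain2[where f=g and g="?v", OF g[OF v[OF that]]])
      (auto intro!: derivative_eq_intros simp: algebra_simps)
  have cont: "continuous_on {0..1} (\<lambda>s. g (?v s))"
    by (rule DERIV_continuous_on, rule has_field_derivative_at_within, erule d)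
  then have "compact ((\<lambda>s. g (?v s)) ` {0..1})"
    by (intro compact_continuous_image) auto
  then obtain c e where ce: "(\<lambda>s. g (?v s)) ` {0..1} \<subseteq> {c..e}"
    using compact_imp_bounded bounded_subset_cbox_symmetric by (metis cbox_interval)
  \<comment> \<open>\<open>s \<mapsto> g (?v s)\<close> runs backwards from \<open>g a\<close> to \<open>g v1\<close>, which accounts for the sign below\<close>
  have "((\<lambda>s. ?d s *\<^sub>R ?f (g (?v s))) has_integral
      (integral {g (?v 0)..g (?v 1)} ?f - integral {g (?v 1)..g (?v 0)} ?f)) {0..1}"
    by (rule has_integral_substitution_general[of "{}" 0 1 _ c e])
      (use cont ce d in \<open>auto intro!: continuous_intros continuous_on_subset[OF U]
          intro: has_field_derivative_at_within\<close>)
  then have "((\<lambda>s. - (?d s * ?f (g (?v s)))) has_integral integral {g v1..g a} ?f) {0..1}"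
    using mono by (auto dest: has_integral_neg)
  moreover have "- (?d s * ?f (g (?v s))) = (2 * sqrt 2 * sqrt (a - v1) ^ 3) * (s\<^sup>2 * k (?v s))"
    if s: "s \<in> {0..1}" for s
  proof -
    have "?f (g (?v s)) = sqrt 2 * sqrt (a - v1) * s"
      using inv[OF v[OF s]] s by (simp add: real_sqrt_mult)
    moreover have "- (K * (- D * (2 * s)) * (sqrt 2 * q * s)) = (2 * sqrt 2 * q ^ 3) * (s\<^sup>2 * K)"
      if "D = q * q" for K D q :: real
      by (simp add: that power2_eq_square power3_eq_cube)
    from this[of "a - v1" "sqrt (a - v1)" "k (?v s)"]
    have "- (?d s * (sqrt 2 * sqrt (a - v1) * s)) = (2 * sqrt 2 * sqrt (a - v1) ^ 3) * (s\<^sup>2 * k (?v s))"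
      using a by simp
    ultimately show ?thesis
      by simp
  qed
  ultimately have "((\<lambda>s. (2 * sqrt 2 * sqrt (a - v1) ^ 3) * (s\<^sup>2 * k (?v s))) has_integral
      integral {g v1..g a} ?f) {0..1}"
    using has_integral_cong[of "{0..1}"] by (smt (verit, ccfv_threshold))
  then have "integral {g v1..g a} ?f = integral {0..1} (\<lambda>s. (2 * sqrt 2 * sqrt (a - v1) ^ 3) * (s\<^sup>2 * k (?v s)))"
    by (rule integral_unique[symmetric])
  then show ?thesis
    by (simp only: integral_mult_right mult.assoc)
qed

section \<open>Inverses of increasing functions\<close>

lemma increasing_the_inv_into:
  fixes f f1 :: "real \<Rightarrow> real"
  assumes S: "open S" "is_interval S"
    and f1: "\<And>x. x \<in> S \<Longrightarrow> (f has_real_derivative f1 x) (at x)" and pos: "\<forall>x\<in>S. 0 < f1 x"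
  shows "strict_mono_on S f" and "open (f ` S)" and "is_interval (f ` S)"
    and "\<And>x. x \<in> S \<Longrightarrow> the_inv_into S f (f x) = x"
    and "\<And>y. y \<in> f ` S \<Longrightarrow> the_inv_into S f y \<in> S \<and> f (the_inv_into S f y) = y"
    and "\<And>y. y \<in> f ` S \<Longrightarrow>
      (the_inv_into S f has_real_derivative inverse (f1 (the_inv_into S f y))) (at y)"
proof -
  have cont: "continuous_on S f"
    by (rule DERIV_continuous_on, rule has_field_derivative_at_within, erule f1)
  show mono: "strict_mono_on S f"
  proof (rule strict_mono_onI)
    fix x y assume xy: "x \<in> S" "y \<in> S" "x < y"
    have sub: "{x..y} \<subseteq> S"
      using S(2) xy by (meson atLeastAtMost_iff is_interval_1 subsetI)
    show "f x < f y"
      by (rule DERIV_pos_imp_increasing[OF xy(3)]) (use sub f1 pos in force)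
  qed
  then have inj: "inj_on f S"
    by (rule strict_mono_on_imp_inj_on)
  show inv: "\<And>x. x \<in> S \<Longrightarrow> the_inv_into S f (f x) = x"
    using inj by (rule the_inv_into_f_f)
  show inv2: "\<And>y. y \<in> f ` S \<Longrightarrow> the_inv_into S f y \<in> S \<and> f (the_inv_into S f y) = y"
    using inj by (auto simp: the_inv_into_f_f)
  show "open (f ` S)"
    using injective_eq_1d_open_map_UNIV[OF cont S(2)] inj S(1) by blast
  show "is_interval (f ` S)"
    using connected_continuous_image[OF cont] S(2) by (simp add: is_interval_connected_1)
  fix y assume "y \<in> f ` S"
  then obtain x where x: "x \<in> S" "y = f x"
    by blast
  have "(the_inv_into S f has_derivative (*) (inverse (f1 x))) (at (f x))"
  proof (rule has_derivative_inverse_strong[OF S(1) x(1) cont inv])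
    show "(f has_derivative (*) (f1 x)) (at x)"
      using f1[OF x(1)] by (simp add: has_field_derivative_def)
    show "(*) (f1 x) \<circ> (*) (inverse (f1 x)) = id"
      using bspec[OF pos x(1)] by (auto simp: fun_eq_iff)
  qed
  then show "(the_inv_into S f has_real_derivative inverse (f1 (the_inv_into S f y))) (at y)"
    using inv[OF x(1)] x(2) by (simp add: has_field_derivative_def)
qed

lemma the_inv_into_second_derivative:
  fixes f f1 f2 :: "real \<Rightarrow> real"
  assumes S: "open S" "is_interval S"
    and f1: "\<And>x. x \<in> S \<Longrightarrow> (f has_real_derivative f1 x) (at x)"
    and f2: "\<And>x. x \<in> S \<Longrightarrow> (f1 has_real_derivative f2 x) (at x)"
    and pos: "\<forall>x\<in>S. 0 < f1 x" and y: "y \<in> f ` S"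
  shows "((\<lambda>y. inverse (f1 (the_inv_into S f y))) has_real_derivative
      - f2 (the_inv_into S f y) * inverse (f1 (the_inv_into S f y)) ^ 3) (at y)"
proof -
  let ?h = "the_inv_into S f"
  have h: "?h y \<in> S" "(?h has_real_derivative inverse (f1 (?h y))) (at y)"
    using increasing_the_inv_into(5,6)[OF S f1 pos y] by auto
  have "((\<lambda>y. f1 (?h y)) has_real_derivative f2 (?h y) * inverse (f1 (?h y))) (at y)"
    by (rule DERIV_chain2[OF f2[OF h(1)] h(2)])
  from DERIV_inverse_fun[OF this] bspec[OF pos h(1)] show ?thesis
    by (simp add: power3_eq_cube mult_ac)
qed

section \<open>Regularity of the action\<close>

text \<open>Locally \<open>r\<close> is the inverse \<open>g\<close> of \<open>U\<close> near the turning point, so the integral splits at a fixed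
\<open>z1\<close> into a bulk part and an edge part. Three derivatives of \<open>U\<close> make \<open>k = g'\<close> of class \<open>C\<^sup>2\<close>,
which the two differentiations under the integral sign of the edge part need.\<close>

lemma well_integral_regular:
  fixes U U1 U2 U3 r :: "real \<Rightarrow> real"
  assumes U: "\<And>x. (U has_real_derivative U1 x) (at x)" "\<And>x. (U1 has_real_derivative U2 x) (at x)"
      "\<And>x. (U2 has_real_derivative U3 x) (at x)" and U3: "continuous_on UNIV U3"
    and J: "open J" "a0 \<in> J"
    and well: "\<And>a. a \<in> J \<Longrightarrow> 0 < r a" "\<And>a z. a \<in> J \<Longrightarrow> U z \<le> a \<longleftrightarrow> \<bar>z\<bar> \<le> r a"
      "\<And>a z. a \<in> J \<Longrightarrow> U z = a \<longleftrightarrow> \<bar>z\<bar> = r a" "\<And>a. a \<in> J \<Longrightarrow> 0 < U1 (r a)"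
  shows "\<exists>N A1 A2. open N \<and> a0 \<in> N \<and> N \<subseteq> J \<and>
    (\<forall>a\<in>N. ((\<lambda>a. integral {0..r a} (\<lambda>z. sqrt (2 * (a - U z)))) has_real_derivative A1 a) (at a) \<and>
      (A1 has_real_derivative A2 a) (at a) \<and> 0 < A1 a)"
proof -
  have contU: "continuous_on S U" "continuous_on S U1" "continuous_on S U2" for S
    by (rule DERIV_continuous_on, rule has_field_derivative_at_within, rule U)+
  define r0 where "r0 = r a0"
  have r0: "0 < r0" "U r0 = a0" "0 < U1 r0"
    using well[OF J(2)] by (auto simp: r0_def)
  obtain d where d: "0 < d" "d < r0" "\<And>x. \<bar>x - r0\<bar> < d \<Longrightarrow> 0 < U1 x"
  proof -
    have "\<forall>\<^sub>F x in at r0. 0 < U1 x"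
      using DERIV_isCont[OF U(2), of r0] r0(3) by (auto simp: isCont_def intro: order_tendstoD)
    then obtain d where d: "d > 0" "\<And>x. x \<noteq> r0 \<Longrightarrow> \<bar>x - r0\<bar> < d \<Longrightarrow> 0 < U1 x"
      by (auto simp: eventually_at dist_real_def)
    show thesis
      by (rule that[of "min d (r0 / 2)"]) (use d r0 in \<open>auto, metis\<close>)
  qed
  define S where "S = {r0 - d<..<r0 + d}"
  define z1 z2 where "z1 = r0 - d / 2" and "z2 = r0 + d / 2"
  define v1 v2 where "v1 = U z1" and "v2 = U z2"
  define g where "g = the_inv_into S U"
  define T where "T = U ` S"
  have S: "open S" "is_interval S"
    by (auto simp: S_def is_interval_1)
  have posS: "\<forall>x\<in>S. 0 < U1 x"
    using d(3) by (auto simp: S_def abs_less_iff)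
  note inv = increasing_the_inv_into[OF S U(1) posS, folded g_def T_def]
  have mem: "z1 \<in> S" "r0 \<in> S" "z2 \<in> S" and z1: "0 < z1" "z1 < r0" "r0 < z2"
    using d r0 by (auto simp: z1_def z2_def S_def)
  have v: "v1 < a0" "a0 < v2" "g v1 = z1"
    using inv(1) inv(4) mem z1 r0(2) by (auto simp: v1_def v2_def strict_mono_on_def)
  have T: "{v1..v2} \<subseteq> T"
  proof
    fix v assume v: "v \<in> {v1..v2}"
    have "v1 \<in> T" "v2 \<in> T"
      using mem by (simp_all add: T_def v1_def v2_def)
    then show "v \<in> T"
      by (rule mem_is_interval_1_I[OF inv(3)]) (use v in auto)
  qed
  define k where "k = (\<lambda>v. inverse (U1 (g v)))"
  define k1 where "k1 = (\<lambda>v. - U2 (g v) * k v ^ 3)"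
  define k2 where "k2 = (\<lambda>v. - (U2 (g v) * (3 * k v ^ 2 * k1 v) + U3 (g v) * k v * k v ^ 3))"
  have gd: "(g has_real_derivative k v) (at v)" if "v \<in> T" for v
    unfolding k_def by (rule inv(6)[OF that])
  have kd: "(k has_real_derivative k1 v) (at v)" if "v \<in> T" for v
    unfolding k_def k1_def g_def
    by (rule the_inv_into_second_derivative[OF S U(1) U(2) posS that[unfolded T_def]])
  have k1d: "(k1 has_real_derivative k2 v) (at v)" if "v \<in> T" for v
  proof -
    have "((\<lambda>v. U2 (g v)) has_real_derivative U3 (g v) * k v) (at v)"
      by (rule DERIV_chain2[OF U(3) gd[OF that]])
    moreover have "((\<lambda>v. k v ^ 3) has_real_derivative 3 * k v ^ 2 * k1 v) (at v)"
      by (rule derivative_eq_intros kd[OF that] refl)+ simp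
    ultimately have "((\<lambda>v. U2 (g v) * k v ^ 3) has_real_derivative
        U2 (g v) * (3 * k v ^ 2 * k1 v) + U3 (g v) * k v * k v ^ 3) (at v)"
      by (rule DERIV_mult')
    from DERIV_minus[OF this] show ?thesis
      unfolding k2_def by (simp only: k1_def mult_minus_left)
  qed
  have contk: "continuous_on T k2"
  proof -
    have "continuous_on T g" "continuous_on T k" "continuous_on T k1"
      by (rule DERIV_continuous_on, rule has_field_derivative_at_within, erule gd kd k1d)+
    moreover from this have "continuous_on T (\<lambda>v. U2 (g v))" "continuous_on T (\<lambda>v. U3 (g v))"
      by (auto intro: continuous_on_compose2[OF contU(3)[of UNIV]] continuous_on_compose2[OF U3])
    ultimately show ?thesis
      unfolding k2_def by (intro continuous_intros)
  qed
  obtain e where e: "0 < e" "ball a0 e \<subseteq> J"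
    using J by (meson open_contains_ball)
  define N where "N = {max v1 (a0 - e)<..<min v2 (a0 + e)}"
  have N: "open N" "convex N" "a0 \<in> N" "N \<subseteq> {v1<..<v2}" "N \<subseteq> J"
    using v e by (auto simp: N_def ball_eq_greaterThanLessThan)
  have NT: "a \<in> T" if "a \<in> N" for a
    using T N(4) that by fastforce
  have ga: "g a \<in> S" "U (g a) = a" "z1 < g a" "r a = g a" if a: "a \<in> N" for a
  proof -
    show g: "g a \<in> S" "U (g a) = a"
      using inv(5)[OF NT[OF a]] by auto
    show "z1 < g a"
    proof (rule ccontr)
      assume "\<not> z1 < g a"
      then have "U (g a) \<le> U z1"
        using inv(1) g(1) mem(1) by (metis linorder_less_linear order_less_imp_le strict_mono_onD
            order_refl)
      then show False
        using g(2) N(4) a by (auto simp: v1_def)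
    qed
    then show "r a = g a"
      using well(3)[of a "g a"] g(2) N(5) a z1(1) by auto
  qed
  let ?A = "\<lambda>a. integral {0..r a} (\<lambda>z. sqrt (2 * (a - U z)))"
  let ?B = "\<lambda>a. integral {0..z1} (\<lambda>z. sqrt (2 * (a - U z)))"
  let ?E = "\<lambda>a. integral {z1..g a} (\<lambda>z. sqrt (2 * (a - U z)))"
  have int: "(\<lambda>z. sqrt (2 * (a - U z))) integrable_on {c..e}" for a c e
    by (intro integrable_continuous_real continuous_intros contU)
  have split: "?A a = ?B a + ?E a" if "a \<in> N" for a
    unfolding ga(4)[OF that]
    by (rule Henstock_Kurzweil_Integration.integral_combine[symmetric])
      (use z1(1) ga(3)[OF that] int in auto)
  have below: "U z < a" if "a \<in> N" "z \<in> {0..z1}" for a z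
    using well(2)[of a z] well(3)[of a z] ga(3,4)[OF that(1)] that N(5) by force
  obtain D1 D2 where D: "\<And>a. a \<in> N \<Longrightarrow> (?B has_real_derivative D1 a) (at a)"
    "\<And>a. a \<in> N \<Longrightarrow> (D1 has_real_derivative D2 a) (at a)" "\<And>a. a \<in> N \<Longrightarrow> 0 < D1 a"
    using bulk_integral_derivatives[OF contU(1) N(1,2) below z1(1)] by blast
  have "twice_differentiable_on (\<lambda>a. 2 * sqrt 2 *
      (sqrt (a - v1) ^ 3 * integral {0..1} (\<lambda>s. s\<^sup>2 * k (a - (a - v1) * s\<^sup>2)))) {v1<..<v2}"
    by (intro twice_differentiable_on_mult edge_integral_twice_differentiable[OF kd k1d contk T])
      (auto intro: twice_differentiable_onI[of _ _ "\<lambda>_. 0" "\<lambda>_. 0"])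
  then obtain E1 E2 where E: "\<And>a. a \<in> {v1<..<v2} \<Longrightarrow> ((\<lambda>a. 2 * sqrt 2 *
      (sqrt (a - v1) ^ 3 * integral {0..1} (\<lambda>s. s\<^sup>2 * k (a - (a - v1) * s\<^sup>2))))
        has_real_derivative E1 a) (at a)"
    "\<And>a. a \<in> {v1<..<v2} \<Longrightarrow> (E1 has_real_derivative E2 a) (at a)"
    unfolding twice_differentiable_on_def by blast
  have E_eq: "?E a = 2 * sqrt 2 *
      (sqrt (a - v1) ^ 3 * integral {0..1} (\<lambda>s. s\<^sup>2 * k (a - (a - v1) * s\<^sup>2)))" if a: "a \<in> N" for a
  proof -
    have sub: "v \<in> T" if "v \<in> {v1..a}" for v
      using T N(4) a that by fastforce
    show ?thesis
      unfolding v(3)[symmetric]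
      by (rule edge_integral_substitution[OF contU(1)])
        (use gd sub inv(5) a N(4) ga(3)[OF a] v(3) in auto)
  qed
  have Ed: "(?E has_real_derivative E1 a) (at a)" if "a \<in> N" for a
    by (rule has_field_derivative_transform_within_open[OF E(1)[OF subsetD[OF N(4) that]] N(1) that])
      (rule E_eq[symmetric])
  \<comment> \<open>the edge integrand is nonnegative and grows with the energy, and so does its interval\<close>
  have "mono_on N ?E"
  proof (rule mono_onI)
    fix a b assume ab: "a \<in> N" "b \<in> N" "a \<le> b"
    have gab: "g a \<le> g b"
      using strict_mono_onD[OF inv(1) ga(1)[OF ab(2)] ga(1)[OF ab(1)]] ga(2) ab by force
    have "?E a \<le> integral {z1..g a} (\<lambda>z. sqrt (2 * (b - U z)))"
      by (rule integral_le[OF int int]) (use ab in auto)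
    also have "\<dots> \<le> ?E b"
    proof (rule integral_subset_le[OF _ int int])
      show "\<forall>z\<in>{z1..g b}. 0 \<le> sqrt (2 * (b - U z))"
        using well(2)[of b] N(5) ab(2) ga(4)[OF ab(2)] z1(1) by auto
    qed (use gab in auto)
    finally show "?E a \<le> ?E b" .
  qed
  then have E1: "0 \<le> E1 a" if "a \<in> N" for a
    using mono_on_imp_deriv_nonneg[OF _ Ed[OF that]] N(1) that by (simp add: interior_open)
  have "(?A has_real_derivative D1 a + E1 a) (at a)" if "a \<in> N" for a
    by (rule has_field_derivative_transform_within_open[OF DERIV_add[OF D(1) Ed] N(1)])
      (use that split in auto)
  moreover have "((\<lambda>a. D1 a + E1 a) has_real_derivative D2 a + E2 a) (at a)" if "a \<in> N" for a
    by (rule DERIV_add[OF D(2) E(2)]) (use that N(4) in auto)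
  moreover have "0 < D1 a + E1 a" if "a \<in> N" for a
    using D(3) E1 that by (simp add: add_pos_nonneg)
  ultimately show ?thesis
    using N by (intro exI[of _ N] exI[of _ "\<lambda>a. D1 a + E1 a"] exI[of _ "\<lambda>a. D2 a + E2 a"]) simp
qed

lemma smooth_energy_potential:
  assumes "smooth V"
  obtains U1 U2 U3 :: "real \<Rightarrow> real"
  where "\<And>x. ((\<lambda>z. V (z\<^sup>2)) has_real_derivative U1 x) (at x)"
    "\<And>x. (U1 has_real_derivative U2 x) (at x)" "\<And>x. (U2 has_real_derivative U3 x) (at x)"
    "continuous_on UNIV U3"
proof -
  define D where "D = (\<lambda>n. (deriv ^^ n) V)"
  have D: "(D n has_real_derivative D (Suc n) x) (at x)" for n x
    using assms unfolding D_def smooth_def by (simp add: DERIV_deriv_iff_real_differentiable)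
  have D_sq: "((\<lambda>z. D n (z\<^sup>2)) has_real_derivative D (Suc n) (x\<^sup>2) * (2 * x)) (at x)" for n x
    by (rule DERIV_chain2[where f="D n" and g="\<lambda>z. z\<^sup>2", OF D]) (auto intro!: derivative_eq_intros)
  let ?U1 = "\<lambda>z. 2 * z * D 1 (z\<^sup>2)"
  let ?U2 = "\<lambda>z. 2 * D 1 (z\<^sup>2) + 4 * z\<^sup>2 * D 2 (z\<^sup>2)"
  let ?U3 = "\<lambda>z. 12 * z * D 2 (z\<^sup>2) + 8 * z ^ 3 * D 3 (z\<^sup>2)"
  show thesis
  proof (rule that[of ?U1 ?U2 ?U3])
    fix x
    show "((\<lambda>z. V (z\<^sup>2)) has_real_derivative ?U1 x) (at x)"
      using D_sq[of 0 x] by (simp add: D_def mult_ac)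
    show "(?U1 has_real_derivative ?U2 x) (at x)"
      using D_sq[of 1 x]
      by (auto intro!: derivative_eq_intros simp: numeral_2_eq_2 power2_eq_square algebra_simps)
    show "(?U2 has_real_derivative ?U3 x) (at x)"
      using D_sq[of 1 x] D_sq[of 2 x]
      by (auto intro!: derivative_eq_intros
          simp: numeral_2_eq_2 numeral_3_eq_3 power2_eq_square power3_eq_cube algebra_simps)
  next
    have "continuous_on UNIV (\<lambda>z. D n (z\<^sup>2))" for n
      by (rule DERIV_continuous_on, rule has_field_derivative_at_within, rule D_sq)
    then show "continuous_on UNIV ?U3"
      by (intro continuous_intros)
  qed
qed

text \<open>The conclusion is in terms of \<open>deriv\<close> because the local derivatives found near different energies
have to be glued to one function on \<open>J\<close>.\<close>

lemma action_regular:
  assumes V: "smooth V" and J: "open J"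
    and reg: "\<And>a. a \<in> J \<Longrightarrow> regular_closed_simple_curve (level_set (energy V) a)" and a: "a \<in> J"
  defines "I \<equiv> action (energy V)"
  shows "(I has_real_derivative deriv I a) (at a) \<and>
    (deriv I has_real_derivative deriv (deriv I) a) (at a) \<and> 0 < deriv I a"
proof -
  define U where "U = (\<lambda>z. V (z\<^sup>2))"
  obtain U1 U2 U3 where U: "\<And>x. (U has_real_derivative U1 x) (at x)"
    "\<And>x. (U1 has_real_derivative U2 x) (at x)" "\<And>x. (U2 has_real_derivative U3 x) (at x)"
    and U3: "continuous_on UNIV U3"
    using smooth_energy_potential[OF V] unfolding U_def by blast
  have contU: "continuous_on S U" "continuous_on S U2" for S
    by (rule DERIV_continuous_on, rule has_field_derivative_at_within, rule U)+
  have level: "level_set (energy V) b = {(z, w). w\<^sup>2 / 2 + U z = b}" for b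
    by (auto simp: level_set_def energy_def U_def)
  let ?\<gamma> = "\<lambda>b. SOME \<gamma>. regular_simple_loop \<gamma> \<and> path_image \<gamma> = level_set (energy V) b"
  have \<gamma>: "regular_simple_loop (?\<gamma> b)" "path_image (?\<gamma> b) = {(z, w). w\<^sup>2 / 2 + U z = b}"
    if "b \<in> J" for b
    using someI_ex[OF reg[OF that, unfolded regular_closed_simple_curve_def]] level by auto
  have "\<exists>r>0. (\<forall>z. U z \<le> b \<longleftrightarrow> \<bar>z\<bar> \<le> r) \<and> (\<forall>z. U z = b \<longleftrightarrow> \<bar>z\<bar> = r) \<and> 0 < U1 r"
    if "b \<in> J" for b
    by (rule regular_level_set_imp_well[OF U(1,2) contU(2) _ \<gamma>[OF that]]) (auto simp: U_def)
  then obtain r where r: "\<And>b. b \<in> J \<Longrightarrow> 0 < r b" "\<And>b z. b \<in> J \<Longrightarrow> U z \<le> b \<longleftrightarrow> \<bar>z\<bar> \<le> r b"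
    "\<And>b z. b \<in> J \<Longrightarrow> U z = b \<longleftrightarrow> \<bar>z\<bar> = r b" "\<And>b. b \<in> J \<Longrightarrow> 0 < U1 (r b)"
    by metis
  let ?A = "\<lambda>b. integral {0..r b} (\<lambda>z. sqrt (2 * (b - U z)))"
  have I: "I b = 2 / pi * ?A b" if b: "b \<in> J" for b
  proof -
    let ?f = "\<lambda>z. sqrt (2 * (b - U z))"
    have int: "?f integrable_on {c..d}" for c d
      by (intro integrable_continuous_real continuous_intros contU)
    have "integral {- r b..r b} ?f = integral {- r b..0} ?f + integral {0..r b} ?f"
      by (rule Henstock_Kurzweil_Integration.integral_combine[symmetric])
        (use r(1)[OF b] int in auto)
    also have "integral {- r b..0} ?f = integral {0..r b} ?f"
      using Henstock_Kurzweil_Integration.integral_reflect_real[of "r b" 0 ?f] by (simp add: U_def)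
    finally have "integral {- r b..r b} ?f = 2 * ?A b"
      by simp
    then show ?thesis
      using abs_integral_w_dz_well[OF contU(1) r(1)[OF b] r(2)[OF b] r(3)[OF b] \<gamma>[OF b]]
      unfolding I_def action_def by simp
  qed
  obtain N A1 A2 where N: "open N" "a \<in> N" "N \<subseteq> J"
    and A: "\<And>b. b \<in> N \<Longrightarrow> (?A has_real_derivative A1 b) (at b)"
      "\<And>b. b \<in> N \<Longrightarrow> (A1 has_real_derivative A2 b) (at b)" "\<And>b. b \<in> N \<Longrightarrow> 0 < A1 b"
    using well_integral_regular[OF U U3 J a r] by blast
  have I1: "(I has_real_derivative 2 / pi * A1 b) (at b)" if "b \<in> N" for b
    by (rule has_field_derivative_transform_within_open[OF DERIV_cmult[OF A(1)[OF that]] N(1) that])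
      (use I N(3) in auto)
  have dI: "deriv I b = 2 / pi * A1 b" if "b \<in> N" for b
    using I1[OF that] by (rule DERIV_imp_deriv)
  have I2: "(deriv I has_real_derivative 2 / pi * A2 a) (at a)"
    by (rule has_field_derivative_transform_within_open[OF DERIV_cmult[OF A(2)[OF N(2)]] N(1,2)])
      (simp add: dI)
  show ?thesis
    using I1[OF N(2)] I2 dI[OF N(2)] A(3)[OF N(2)] DERIV_imp_deriv[OF I2] by simp
qed

section \<open>Convexity of the relation between the actions\<close>

text \<open>The second derivative test is applicable because \<open>h' = 1 / (f' \<circ> h)\<close> holds on an open set and is
differentiable there; without this, \<open>deriv (deriv h)\<close> carries no information.\<close>

lemma inverse_function_convexity:
  fixes f :: "real \<Rightarrow> real"
  assumes S: "open S" "is_interval S"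
    and f: "\<forall>x\<in>S. (f has_real_derivative deriv f x) (at x) \<and>
      (deriv f has_real_derivative deriv (deriv f) x) (at x) \<and> 0 < deriv f x"
  defines "h \<equiv> the_inv_into S f"
  shows "\<forall>y\<in>f ` S. deriv (deriv h) y < 0 \<Longrightarrow> concave_on (f ` S) h"
    and "\<forall>y\<in>f ` S. 0 < deriv (deriv h) y \<Longrightarrow> convex_on (f ` S) h"
proof -
  have f1: "\<And>x. x \<in> S \<Longrightarrow> (f has_real_derivative deriv f x) (at x)"
    and f2: "\<And>x. x \<in> S \<Longrightarrow> (deriv f has_real_derivative deriv (deriv f) x) (at x)"
    and pos: "\<forall>x\<in>S. 0 < deriv f x"
    using f by auto
  note inv = increasing_the_inv_into[OF S f1 pos, folded h_def]
  have Y: "open (f ` S)" "convex (f ` S)"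
    using inv(2,3) by (auto simp: is_interval_convex_1)
  have h1: "(h has_real_derivative inverse (deriv f (h y))) (at y)" if "y \<in> f ` S" for y
    using inv(6) that by blast
  have dh: "deriv h y = inverse (deriv f (h y))" if "y \<in> f ` S" for y
    using h1[OF that] by (rule DERIV_imp_deriv)
  have h1': "(h has_real_derivative deriv h y) (at y)" if "y \<in> f ` S" for y
    using h1[OF that] dh[OF that] by simp
  have h2: "(deriv h has_real_derivative deriv (deriv h) y) (at y)" if y: "y \<in> f ` S" for y
  proof -
    have "((\<lambda>y. inverse (deriv f (h y))) has_real_derivative
        - deriv (deriv f) (h y) * inverse (deriv f (h y)) ^ 3) (at y)"
      unfolding h_def by (rule the_inv_into_second_derivative[OF S f1 f2 pos y])
    then have "(deriv h has_real_derivative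
        - deriv (deriv f) (h y) * inverse (deriv f (h y)) ^ 3) (at y)"
      by (rule has_field_derivative_transform_within_open[OF _ Y(1) y]) (simp add: dh)
    then show ?thesis
      using DERIV_imp_deriv by metis
  qed
  show "concave_on (f ` S) h" if "\<forall>y\<in>f ` S. deriv (deriv h) y < 0"
    by (rule f''_le0_imp_concave[OF Y(2) h1' h2]) (use that in \<open>auto intro: less_imp_le\<close>)
  show "convex_on (f ` S) h" if "\<forall>y\<in>f ` S. 0 < deriv (deriv h) y"
    by (rule f''_ge0_imp_convex[OF Y(2) h1' h2]) (use that in \<open>auto intro: less_imp_le\<close>)
qed

text \<open>For concave \<open>h1\<close> and \<open>h2\<close>: \<open>h2 (\<phi> (u x + v y)) = m - h1 (u x + v y) \<le> u h2 (\<phi> x) + v h2 (\<phi> y)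
\<le> h2 (u \<phi> x + v \<phi> y)\<close>, and \<open>h2\<close> reflects the order.\<close>

lemma convexity_of_implicit_function:
  fixes h1 h2 \<phi> :: "real \<Rightarrow> real"
  assumes rel: "\<forall>x\<in>X. h1 x + h2 (\<phi> x) = m" and \<phi>: "\<phi> ` X \<subseteq> Y"
    and order: "\<forall>x\<in>Y. \<forall>y\<in>Y. h2 x \<le> h2 y \<longrightarrow> x \<le> y"
  shows "concave_on X h1 \<Longrightarrow> concave_on Y h2 \<Longrightarrow> convex_on X \<phi>"
    and "convex_on X h1 \<Longrightarrow> convex_on Y h2 \<Longrightarrow> concave_on X \<phi>"
proof -
  have h2: "h2 (\<phi> x) = m - h1 x" if "x \<in> X" for x
    using bspec[OF rel that] by simp
  have comb: "u * (m - s) + v * (m - t) = m - (u * s + v * t)" if "u + v = 1" for u v s t :: real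
  proof -
    have "u * (m - s) + v * (m - t) = (u + v) * m - (u * s + v * t)"
      by (simp add: algebra_simps)
    then show ?thesis
      using that by simp
  qed
  {
    assume c1: "concave_on X h1" and c2: "concave_on Y h2"
    have ineq1: "u * h1 x + v * h1 y \<le> h1 (u * x + v * y)"
      if "x \<in> X" "y \<in> X" "0 \<le> u" "0 \<le> v" "u + v = 1" for x y u v
      using c1 that unfolding concave_on_iff real_scaleR_def by blast
    have ineq2: "u * h2 x + v * h2 y \<le> h2 (u * x + v * y)"
      if "x \<in> Y" "y \<in> Y" "0 \<le> u" "0 \<le> v" "u + v = 1" for x y u v
      using c2 that unfolding concave_on_iff real_scaleR_def by blast
    show "convex_on X \<phi>"
      unfolding convex_on_def
    proof (intro conjI ballI allI impI)
      show X: "convex X"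
        using c1 by (simp add: concave_on_iff)
      have Y: "convex Y"
        using c2 by (simp add: concave_on_iff)
      fix x y u v :: real
      assume *: "x \<in> X" "y \<in> X" "0 \<le> u" "0 \<le> v" "u + v = 1"
      have X': "u * x + v * y \<in> X" and Y': "u * \<phi> x + v * \<phi> y \<in> Y"
        using convexD[OF X *] convexD[OF Y _ _ *(3,4,5)] \<phi> *(1,2) by auto
      have "h2 (\<phi> (u * x + v * y)) \<le> m - (u * h1 x + v * h1 y)"
        using ineq1[OF *] by (simp add: h2[OF X'])
      also have "\<dots> = u * h2 (\<phi> x) + v * h2 (\<phi> y)"
        using * by (simp add: h2 comb)
      also have "\<dots> \<le> h2 (u * \<phi> x + v * \<phi> y)"
        using \<phi> *(1,2) by (intro ineq2 *(3,4,5)) auto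
      finally have "\<phi> (u * x + v * y) \<le> u * \<phi> x + v * \<phi> y"
        using order X' Y' \<phi> by blast
      then show "\<phi> (u *\<^sub>R x + v *\<^sub>R y) \<le> u * \<phi> x + v * \<phi> y"
        by simp
    qed
  }
  {
    assume c1: "convex_on X h1" and c2: "convex_on Y h2"
    have ineq1: "h1 (u * x + v * y) \<le> u * h1 x + v * h1 y"
      if "x \<in> X" "y \<in> X" "0 \<le> u" "0 \<le> v" "u + v = 1" for x y u v
      using c1 that unfolding convex_on_def real_scaleR_def by blast
    have ineq2: "h2 (u * x + v * y) \<le> u * h2 x + v * h2 y"
      if "x \<in> Y" "y \<in> Y" "0 \<le> u" "0 \<le> v" "u + v = 1" for x y u v
      using c2 that unfolding convex_on_def real_scaleR_def by blast
    show "concave_on X \<phi>"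
      unfolding concave_on_iff
    proof (intro conjI ballI allI impI)
      show X: "convex X"
        using c1 by (simp add: convex_on_def)
      have Y: "convex Y"
        using c2 by (simp add: convex_on_def)
      fix x y u v :: real
      assume *: "x \<in> X" "y \<in> X" "0 \<le> u" "0 \<le> v" "u + v = 1"
      have X': "u * x + v * y \<in> X" and Y': "u * \<phi> x + v * \<phi> y \<in> Y"
        using convexD[OF X *] convexD[OF Y _ _ *(3,4,5)] \<phi> *(1,2) by auto
      have "h2 (u * \<phi> x + v * \<phi> y) \<le> u * h2 (\<phi> x) + v * h2 (\<phi> y)"
        using \<phi> *(1,2) by (intro ineq2 *(3,4,5)) auto
      also have "\<dots> = m - (u * h1 x + v * h1 y)"
        using * by (simp add: h2 comb)
      also have "\<dots> \<le> h2 (\<phi> (u * x + v * y))"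
        using ineq1[OF *] by (simp add: h2[OF X'])
      finally have "u * \<phi> x + v * \<phi> y \<le> \<phi> (u * x + v * y)"
        using order X' Y' \<phi> by blast
      then show "u * \<phi> x + v * \<phi> y \<le> \<phi> (u *\<^sub>R x + v *\<^sub>R y)"
        by simp
    qed
  }
qed

theorem mainTheorem5:
  fixes V1 V2 I1 I2 h1 h2 \<phi> :: "real \<Rightarrow> real" and m :: real and J :: "real set"
  assumes "smooth V1" and "smooth V2"
    and "open J" and "is_interval J"
    and "\<And>a. a \<in> J \<Longrightarrow> regular_closed_simple_curve (level_set (energy V1) a)"
    and "\<And>a. a \<in> J \<Longrightarrow> regular_closed_simple_curve (level_set (energy V2) (m - a))"
    and "I1 = action (energy V1)" and "I2 = action (energy V2)"
    and "h1 = the_inv_into J I1"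
    and "h2 = the_inv_into ((\<lambda>a. m - a) ` J) I2"
    and "\<And>a. a \<in> J \<Longrightarrow> \<phi> (I1 a) = I2 (m - a)"
  shows "((\<forall>x \<in> I1 ` J. deriv (deriv h1) x < 0) \<and>
          (\<forall>y \<in> I2 ` (\<lambda>a. m - a) ` J. deriv (deriv h2) y < 0)
            \<longrightarrow> convex_on (I1 ` J) \<phi>) \<and>
         ((\<forall>x \<in> I1 ` J. deriv (deriv h1) x > 0) \<and>
          (\<forall>y \<in> I2 ` (\<lambda>a. m - a) ` J. deriv (deriv h2) y > 0)
            \<longrightarrow> concave_on (I1 ` J) \<phi>)"
proof -
  let ?J2 = "(\<lambda>a. m - a) ` J"
  have J2: "open ?J2" "is_interval ?J2"
  proof -
    have "(\<lambda>a. m - a) ` J = (\<lambda>a. m + (- 1) *\<^sub>R a) ` J"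
      by simp
    then show "open ?J2"
      using open_affinity[of J "- 1" m] assms(3) by simp
    show "is_interval ?J2"
      using assms(4) by (simp add: is_interval_minus_translation)
  qed
  have I1: "\<forall>a\<in>J. (I1 has_real_derivative deriv I1 a) (at a) \<and>
      (deriv I1 has_real_derivative deriv (deriv I1) a) (at a) \<and> 0 < deriv I1 a"
    unfolding assms(7) using action_regular[OF assms(1,3,5)] by blast
  have I2: "\<forall>b\<in>?J2. (I2 has_real_derivative deriv I2 b) (at b) \<and>
      (deriv I2 has_real_derivative deriv (deriv I2) b) (at b) \<and> 0 < deriv I2 b"
  proof
    fix b assume "b \<in> ?J2"
    show "(I2 has_real_derivative deriv I2 b) (at b) \<and>
        (deriv I2 has_real_derivative deriv (deriv I2) b) (at b) \<and> 0 < deriv I2 b"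
      unfolding assms(8) by (rule action_regular[OF assms(2) J2(1) _ \<open>b \<in> ?J2\<close>]) (use assms(6) in auto)
  qed
  note inv1 = increasing_the_inv_into[OF assms(3,4), of I1 "deriv I1", folded assms(9)]
  note inv2 = increasing_the_inv_into[OF J2, of I2 "deriv I2", folded assms(10)]
  have h1: "h1 (I1 a) = a" if "a \<in> J" for a
    using inv1(4) I1 that by blast
  have h2: "h2 (I2 b) = b" if "b \<in> ?J2" for b
    using inv2(4) I2 that by blast
  have mono: "strict_mono_on ?J2 I2"
    using inv2(1) I2 by blast
  have rel: "\<forall>x\<in>I1 ` J. h1 x + h2 (\<phi> x) = m"
    using h1 h2 assms(11) by auto
  have range: "\<phi> ` I1 ` J \<subseteq> I2 ` ?J2"
    using assms(11) by auto
  have order: "\<forall>x\<in>I2 ` ?J2. \<forall>y\<in>I2 ` ?J2. h2 x \<le> h2 y \<longrightarrow> x \<le> y"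
  proof (intro ballI impI)
    fix x y assume xy: "x \<in> I2 ` ?J2" "y \<in> I2 ` ?J2" "h2 x \<le> h2 y"
    from xy(1) obtain b where b: "x = I2 b" "b \<in> ?J2"
      by (rule imageE)
    from xy(2) obtain c where c: "y = I2 c" "c \<in> ?J2"
      by (rule imageE)
    have "b \<le> c"
      using xy(3) h2[OF b(2)] h2[OF c(2)] b(1) c(1) by simp
    then show "x \<le> y"
      using strict_mono_on_leD[OF mono b(2) c(2)] b(1) c(1) by simp
  qed
  note conv = convexity_of_implicit_function[OF rel range order]
  note c1 = inverse_function_convexity[OF assms(3,4) I1, folded assms(9)]
  note c2 = inverse_function_convexity[OF J2 I2, folded assms(10)]
  show ?thesis
    by (intro conjI impI; elim conjE) (rule conv(1)[OF c1(1) c2(1)] conv(2)[OF c1(2) c2(2)]; assumption)+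
qed

end
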